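(* Let $\mathcal{P}_m^L$ be the digital net in base $2$ generated by the matrices $C_1=J_m$ and $C_2=L_m$. For all integers $m\geq 4$ we have $$\mathrm{disp}(\mathcal{P}_m^{L})\geq \max_{k=2,\dots,m-2}\left(\frac{2^{k+1}-1}{2^m}\left(\frac{1}{2^{k-1}}-\frac{1}{2^{m}}\right)\right)=\begin{cases}\dfrac{1}{2^m}\left(4-\dfrac{4}{2^{\frac{m}{2}}}+\dfrac{1}{2^m}\right) & \text{if } m \text{ is even},\\[2mm] \dfrac{1}{2^m}\left(4-\dfrac{3}{2^{\frac{m-1}{2}}}+\dfrac{1}{2^m}\right) & \text{if } m \text{ is odd}.\end{cases}$$
   Context: Dispersion: let $\mathcal{B}:=\{[x_1,y_1)\times[x_2,y_2)\mid 0\le x_1\le y_1\le 1,\ 0\le x_2\le y_2\le 1\}$. For a finite point set $\mathcal{P}\subset[0,1]^2$, $\mathrm{disp}(\mathcal{P}):=\sup_{B\in\mathcal{B},\,B\cap\mathcal{P}=\emptyset}\lambda(B)$, where $\lambda(B)$ is the area of $B$. Digital nets in base $2$: identify $\mathbb{Z}_2$, the field with $2$ elements, with $\{0,1\}$. Let $C_1,C_2$ be two $m\times m$ matrices over $\mathbb{Z}_2$. For $n\in\{0,1,\dots,2^m-1\}$ with binary expansion $n=e_1+2e_2+\dots+2^{m-1}e_m$, $e_i\in\{0,1\}$, put $\vec n=(e_1,\dots,e_m)^\top$, compute $C_j\vec n=:(y^{(j)}_{n,1},\dots,y^{(j)}_{n,m})^\top$ over $\mathbb{Z}_2$, set $x_n^{(j)}=\sum_{i=1}^m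 y^{(j)}_{n,i}\,2^{-i}$ for $j=1,2$, and $\boldsymbol{x}_n=(x_n^{(1)},x_n^{(2)})$. The digital net generated by $C_1$ and $C_2$ is $\{\boldsymbol{x}_0,\dots,\boldsymbol{x}_{2^m-1}\}$. $J_m$ is the $m\times m$ matrix with entries $1$ on the anti-diagonal (positions $(i,m+1-i)$) and $0$ elsewhere. $L_m$ is the $m\times m$ lower triangular matrix over $\mathbb{Z}_2$ with all entries on and below the main diagonal equal to $1$ and all entries above it equal to $0$. The maximum is over integers $k$. *)

theory Defs
  imports "HOL-Analysis.Analysis" "HOL-Library.Z2" "Jordan_Normal_Form.Matrix"
begin

definition boxes :: "(real \<times> real) set set" where
  "boxes = {{x1..<y1} \<times> {x2..<y2} | x1 y1 x2 y2.
              0 \<le> x1 \<and> x1 \<le> y1 \<and> y1 \<le> 1 \<and> 0 \<le> x2 \<and> x2 \<le> y2 \<and> y2 \<le> 1}"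

text \<open>The areas form a subset of \<open>{0..1}\<close>, and the empty box always contributes the value 0, so the
  supremum in the reals is a proper one.\<close>

definition dispersion :: "(real \<times> real) set \<Rightarrow> real" where
  "dispersion P = (SUP B \<in> {B \<in> boxes. B \<inter> P = {}}. measure lborel B)"

text \<open>Vectors and matrices are indexed from 0: entry \<open>i\<close> here is entry \<open>i + 1\<close> in the usual
  notation. Accordingly the digit vector of \<open>n\<close> has the coefficient of \<open>2 ^ i\<close> at index \<open>i\<close> (least
  significant digit first), and the output digit at index \<open>i\<close> carries the weight \<open>1 / 2 ^ (i + 1)\<close>.\<close>

definition digit_vec :: "nat \<Rightarrow> nat \<Rightarrow> bit vec" where
  "digit_vec m n = vec m (\<lambda>i. of_nat (n div 2 ^ i mod 2))"

definition net_coord :: "nat \<Rightarrow> bit mat \<Rightarrow> nat \<Rightarrow> real" where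
  "net_coord m C n = (\<Sum>i<m. of_bit (vec_index (C *\<^sub>v digit_vec m n) i) / 2 ^ (i + 1))"

definition digital_net :: "nat \<Rightarrow> bit mat \<Rightarrow> bit mat \<Rightarrow> (real \<times> real) set" where
  "digital_net m C1 C2 = (\<lambda>n. (net_coord m C1 n, net_coord m C2 n)) ` {0..<2 ^ m}"

definition J_mat :: "nat \<Rightarrow> bit mat" where
  "J_mat m = mat m m (\<lambda>(i, j). if i + j + 1 = m then 1 else 0)"

definition L_mat :: "nat \<Rightarrow> bit mat" where
  "L_mat m = mat m m (\<lambda>(i, j). if j \<le> i then 1 else 0)"

end

theory Submission
  imports Defs
begin

text \<open>
  For every \<open>k\<close> with \<open>2 \<le> k \<le> m - 2\<close> there is one explicit open box without net points, namely,
  with all coordinates in units of \<open>2\<^sup>-\<^sup>m\<close>,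
  \<open>(3, 2 ^ (k + 1) + 2) \<times> (2 ^ (m - 1) - 2 ^ (m - k), 2 ^ (m - 1) + 2 ^ (m - k) - 1)\<close>.
  Its area is the \<open>k\<close>-th term of the maximum. Open boxes do not belong to the family over
  which the dispersion is a supremum, but shrinking them slightly at the lower left corner gives
  members of the family whose areas tend to the area of the open box (\<open>open_box_le_dispersion\<close>).

  The box is empty for the following reason. The matrix \<open>J\<close> reverses the binary digits of \<open>n\<close>,
  so that the first coordinate of the \<open>n\<close>-th point is \<open>n / 2 ^ m\<close>; the points in the vertical strip
  are those with \<open>3 < n < 2 ^ (k + 1) + 2\<close>. The digits of the second coordinate are the prefix
  parities \<open>d\<^sub>0, d\<^sub>1, \<dots>\<close> of the binary digits of \<open>n\<close>. A number with digits \<open>d\<^sub>i\<close> can be close to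
  \<open>1 / 2\<close> only if it looks like \<open>0.0111\<dots>\<close> or \<open>0.1000\<dots>\<close>, that is, if the digits after the first one
  are the opposite of the first one for a long time. If this holds for the first \<open>k\<close> digits, then
  the last \<open>k\<close> binary digits of \<open>n\<close> are \<open>0\<dots>010\<close> or \<open>0\<dots>011\<close>, and the only such \<open>n\<close> in
  the strip are \<open>2 ^ k + 2\<close> and \<open>2 ^ k + 3\<close>. For these two, the parity flips back
  at position \<open>k\<close> and remains constant, which places the second coordinate exactly on one of the
  two horizontal sides of the box. The lemma \<open>parity_digits_return\<close> is this
  dichotomy for \<open>n\<close>, and \<open>binary_sum_away_from_half\<close> translates it into the distance from the middle.

  For the value of the maximum, the \<open>k\<close>-th term decreases with \<open>2 ^ k + 2 ^ (m - k)\<close>. This is a sum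
  of two powers of two with fixed product, hence smallest when the exponents are as equal as possible.
\<close>

section \<open>Coordinates of the net points\<close>

definition parity_digit :: "nat \<Rightarrow> nat \<Rightarrow> bit" where
  "parity_digit n i = (\<Sum>j\<le>i. of_bool (bit n j))"

lemma parity_digit_Suc: "parity_digit n (Suc i) = parity_digit n i + of_bool (bit n (Suc i))"
  by (simp add: parity_digit_def)

lemma vec_index_digit_vec: "j < m \<Longrightarrow> digit_vec m n $ j = of_bool (bit n j)"
  by (simp add: digit_vec_def bit_iff_odd mod_2_eq_odd)

text \<open>Row \<open>i\<close> of \<open>L\<close> adds up the digits \<open>0, \<dots>, i\<close> modulo two.\<close>

lemma net_coord_L_mat:
  "net_coord m (L_mat m) n = (\<Sum>i<m. of_bit (parity_digit n i) / 2 ^ (i + 1))"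
proof -
  have "(L_mat m *\<^sub>v digit_vec m n) $ i = parity_digit n i" if "i < m" for i
  proof -
    have "(L_mat m *\<^sub>v digit_vec m n) $ i
        = (\<Sum>j\<in>{0..<m}. (if j \<le> i then 1 else 0) * of_bool (bit n j))"
      using that by (simp add: L_mat_def scalar_prod_def vec_index_digit_vec digit_vec_def
          bit_iff_odd mod_2_eq_odd)
    also have "\<dots> = (\<Sum>j\<in>{..i}. of_bool (bit n j))"
      using that by (intro sum.mono_neutral_cong_right) auto
    finally show ?thesis by (simp add: parity_digit_def)
  qed
  then show ?thesis by (simp add: net_coord_def)
qed

text \<open>The reversal of the digit vector puts the coefficient of \<open>2 ^ j\<close> at the output position of weight
  \<open>2 ^ j / 2 ^ m\<close>.\<close>

lemma net_coord_J_mat: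
  assumes "n < 2 ^ m"
  shows "net_coord m (J_mat m) n = real n / 2 ^ m"
proof -
  have digit: "(J_mat m *\<^sub>v digit_vec m n) $ i = of_bool (bit n (m - Suc i))" if "i < m" for i
  proof -
    have "(J_mat m *\<^sub>v digit_vec m n) $ i
        = (\<Sum>j\<in>{0..<m}. (if i + j + 1 = m then 1 else 0) * of_bool (bit n j))"
      using that by (simp add: J_mat_def scalar_prod_def digit_vec_def bit_iff_odd mod_2_eq_odd)
    also have "\<dots> = (\<Sum>j\<in>{m - Suc i}. of_bool (bit n j))"
      using that by (intro sum.mono_neutral_cong_right) auto
    finally show ?thesis by simp
  qed
  have "net_coord m (J_mat m) n = (\<Sum>i<m. of_bool (bit n (m - Suc i)) / 2 ^ (i + 1))"
    unfolding net_coord_def by (intro sum.cong) (auto simp: digit)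
  also have "\<dots> = (\<Sum>i<m. of_bool (bit n (m - Suc i)) * 2 ^ (m - Suc i) / 2 ^ m)"
  proof (intro sum.cong refl)
    fix i assume "i \<in> {..<m}"
    then have "(2::real) ^ m = 2 ^ (i + 1) * 2 ^ (m - Suc i)"
      by (subst power_add [symmetric]) simp
    then show "of_bool (bit n (m - Suc i)) / 2 ^ (i + 1)
        = (of_bool (bit n (m - Suc i)) * 2 ^ (m - Suc i) / 2 ^ m :: real)"
      by simp
  qed
  also have "\<dots> = (\<Sum>j<m. of_bool (bit n j) * 2 ^ j / 2 ^ m)"
    by (rule sum.nat_diff_reindex)
  also have "\<dots> = real (\<Sum>j<m. of_bool (bit n j) * 2 ^ j) / 2 ^ m"
    by (simp add: sum_divide_distrib del: sum_of_bool_mult_eq)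
  also have "(\<Sum>j<m. of_bool (bit n j) * 2 ^ j) = take_bit m n"
    by (simp add: take_bit_sum push_bit_eq_mult atLeast0LessThan)
  also have "take_bit m n = n"
    using assms by (simp add: take_bit_nat_eq_self)
  finally show ?thesis .
qed

section \<open>The empty box\<close>

lemma odd_bit_iff_eq_one: "odd (b :: bit) \<longleftrightarrow> b = 1"
  by (cases b) auto

text \<open>The parity digit changes exactly where \<open>n\<close> has a one. If it differs from its first value throughout
  the positions \<open>1, \<dots>, k - 1\<close>, then \<open>n\<close> is congruent to 2 or 3 modulo \<open>2 ^ k\<close>. Of these residues the
  bounds on \<open>n\<close> exclude the representatives \<open>2, 3\<close> as well as \<open>2 ^ (k + 1) + 2, 2 ^ (k + 1) + 3\<close>
  and all larger ones, so bit \<open>k\<close> is the only nonzero one among the bits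
  \<open>k, k + 1, \<dots>\<close> of \<open>n\<close>, and it makes the parity return for good.\<close>

lemma parity_digits_return:
  assumes "2 \<le> k" "3 < n" "n < 2 ^ (k + 1) + 2"
  shows "(\<exists>j\<in>{1..<k}. parity_digit n j = parity_digit n 0) \<or>
         (\<forall>i\<ge>k. parity_digit n i = parity_digit n 0)"
proof (intro disj_imp [THEN iffD2] impI)
  let ?d = "parity_digit n"
  assume "\<not> (\<exists>j\<in>{1..<k}. ?d j = ?d 0)"
  then have flip: "?d j = ?d 0 + 1" if "1 \<le> j" "j < k" for j
    using that by (cases "?d j"; cases "?d 0") auto
  have bit1: "bit n 1"
    using flip[of 1] parity_digit_Suc[of n 0] assms
    by (cases "bit n 1"; cases "?d 0") auto
  have low: "\<not> bit n j" if "2 \<le> j" "j < k" for j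
  proof -
    have "?d (Suc (j - 1)) = ?d (j - 1) + of_bool (bit n (Suc (j - 1)))"
      by (rule parity_digit_Suc)
    with that flip[of j] flip[of "j - 1"] show ?thesis
      by (cases "bit n j"; cases "?d 0") auto
  qed
  define b where "b = n mod 2"
  have b: "b < 2" by (simp add: b_def)
  have "take_bit k n = 2 + b"
  proof (rule bit_eqI)
    fix j
    have "bit (2 + b) j \<longleftrightarrow> (j = 0 \<and> odd n \<or> j = 1)"
    proof -
      consider "j = 0" | "j = 1" | i where "j = Suc (Suc i)" by (metis One_nat_def not0_implies_Suc)
      then show ?thesis
      proof cases
        case 3 then show ?thesis using b by (auto simp: bit_Suc)
      qed (use b in \<open>auto simp: bit_Suc bit_0 b_def\<close>)
    qed
    moreover consider "j = 0" | "j = 1" | "2 \<le> j" by linarith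
    then have "bit (take_bit k n) j \<longleftrightarrow> (j = 0 \<and> odd n \<or> j = 1)"
      using assms bit1 low[of j] by cases (auto simp: bit_take_bit_iff bit_0)
    ultimately show "bit (take_bit k n) j = bit (2 + b) j" by blast
  qed
  then have mod: "n mod 2 ^ k = 2 + b" by (simp add: take_bit_eq_mod)
  have n_eq: "n = 2 ^ k * (n div 2 ^ k) + (2 + b)"
    using mod by (metis mult_div_mod_eq)
  have div: "n div 2 ^ k = 1"
  proof -
    have "n div 2 ^ k \<noteq> 0" 
    proof
      assume "n div 2 ^ k = 0"
      then have "n = 2 + b" using n_eq by simp
      then show False using b assms by simp
    qed
    moreover have "n div 2 ^ k < 2"

    proof (rule ccontr)
      assume "\<not> n div 2 ^ k < 2"
      then have "2 ^ k * 2 \<le> 2 ^ k * (n div 2 ^ k)" by (intro mult_le_mono) auto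
      moreover have "n < 2 ^ k * 2 + 2" using assms by simp
      ultimately show False using n_eq by linarith
    qed
    ultimately show ?thesis by linarith
  qed
  have high: "bit n i \<longleftrightarrow> i = k" if "k \<le> i" for i
  proof -
    have "bit n i = bit (drop_bit k n) (i - k)"
      using that by (simp add: bit_drop_bit_eq)
    then show ?thesis using that div by (auto simp: drop_bit_eq_div bit_1_iff simp del: One_nat_def)
  qed
  have "?d k = ?d 0"
    using parity_digit_Suc[of n "k - 1"] flip[of "k - 1"] high[of k] assms
    by (cases "?d 0") auto
  have "?d i = ?d 0" if "k \<le> i" for i
    using that
  proof (induction i rule: dec_induct)
    case (step i)
    then have "\<not> bit n (Suc i)" using high[of "Suc i"] by simp
    with step.IH show ?case by (simp only: parity_digit_Suc of_bool_eq add_0_right)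
  qed fact
  then show "\<forall>i\<ge>k. ?d i = ?d 0" by blast
qed

lemma sum_binary_weights:
  "a \<le> b \<Longrightarrow> (\<Sum>i\<in>{a..<b}. 1 / 2 ^ (i + 1)) = (1 / 2 ^ a - 1 / 2 ^ b :: real)"
proof (induction b rule: dec_induct)
  case (step n)
  have "(\<Sum>i\<in>{a..<Suc n}. 1 / 2 ^ (i + 1)) = (1 / 2 ^ a - 1 / 2 ^ n + 1 / 2 ^ (n + 1) :: real)"
    using step by (simp only: sum.atLeastLessThan_Suc)
  also have "\<dots> = 1 / 2 ^ a - 1 / 2 ^ Suc n" by simp
  finally show ?case .
qed simp

text \<open>The two bounds are exchanged by complementing all digits, which maps \<open>y\<close> to \<open>1 - 1 / 2 ^ m - y\<close>. It
  is therefore enough to bound from below the total weight \<open>z\<close> of the positions whose digit agrees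
  with the first one: \<open>y\<close> is \<open>z\<close> or its mirror image, according to the first digit. Position 0
  contributes \<open>1 / 2\<close>, and the agreeing positions provided by the hypothesis contribute either at
  least \<open>1 / 2 ^ k\<close>, or the whole tail of weight \<open>1 / 2 ^ k - 1 / 2 ^ m\<close>.\<close>

lemma binary_sum_away_from_half:
  fixes d :: "nat \<Rightarrow> bit"
  assumes k: "1 \<le> k" "k < m"
  assumes return: "(\<exists>j\<in>{1..<k}. d j = d 0) \<or> (\<forall>i\<ge>k. d i = d 0)"
  defines "y \<equiv> (\<Sum>i<m. of_bit (d i) / 2 ^ (i + 1)) :: real"
  shows "y \<le> 1 / 2 - 1 / 2 ^ k \<or> y \<ge> 1 / 2 + 1 / 2 ^ k - 1 / 2 ^ m"
proof -
  define I where "I = {i. i < m \<and> d i = d 0}"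
  define z :: real where "z = (\<Sum>i\<in>I. 1 / 2 ^ (i + 1))"
  have bound: "z \<ge> (\<Sum>i\<in>A. 1 / 2 ^ (i + 1))" if "A \<subseteq> I" for A
    unfolding z_def using that by (intro sum_mono2) (auto simp: I_def)
  have z: "z \<ge> 1 / 2 + 1 / 2 ^ k - 1 / 2 ^ m"
    using return
  proof
    assume "\<exists>j\<in>{1..<k}. d j = d 0"
    then obtain j where j: "1 \<le> j" "j < k" "d j = d 0" by auto
    have "1 / 2 + 1 / 2 ^ (j + 1) \<le> z"
      using bound[of "{0, j}"] j k by (simp add: I_def)
    moreover have "(1::real) / 2 ^ k \<le> 1 / 2 ^ (j + 1)"
      using j by (intro divide_left_mono power_increasing) auto
    ultimately show ?thesis by (smt (verit) divide_nonneg_nonneg zero_le_power)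
  next
    assume "\<forall>i\<ge>k. d i = d 0"
    then have "(\<Sum>i\<in>insert 0 {k..<m}. 1 / 2 ^ (i + 1)) \<le> z"
      using k by (intro bound) (auto simp: I_def)
    then show ?thesis
      using k sum_binary_weights[of k m] by simp
  qed
  have total: "(\<Sum>i<m. 1 / 2 ^ (i + 1)) = (1 - 1 / 2 ^ m :: real)"
    using sum_binary_weights[of 0 m] by (simp add: atLeast0LessThan)
  have z_alt: "z = (\<Sum>i<m. of_bool (d i = d 0) / 2 ^ (i + 1))"
    unfolding z_def by (rule sum.mono_neutral_cong_left) (auto simp: I_def)
  show ?thesis
  proof (cases "d 0")
    case one
    then have "y = z"
      unfolding y_def z_alt by (intro sum.cong refl) (simp add: odd_bit_iff_eq_one)
    then show ?thesis using z by simp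
  next
    case zero
    then have "y + z = (\<Sum>i<m. 1 / 2 ^ (i + 1))"
      unfolding y_def z_alt sum.distrib [symmetric]
      by (intro sum.cong refl) (auto simp: odd_bit_iff_eq_one)
    then show ?thesis using z total by simp
  qed
qed

section \<open>Dispersion bounds from boxes\<close>

lemma measure_half_open_box:
  assumes "a \<le> b" "c \<le> d"
  shows "measure lborel ({a..<b} \<times> {c..<d} :: (real \<times> real) set) = (b - a) * (d - c)"
  using assms by (simp add: measure_def lborel_prod [symmetric] lborel.emeasure_pair_measure_Times enn2real_mult)

lemma measure_le_dispersion:
  assumes "B \<in> boxes" "B \<inter> P = {}"
  shows "measure lborel B \<le> dispersion P"
  unfolding dispersion_def
proof (rule cSUP_upper)
  show "bdd_above (measure lborel ` {B \<in> boxes. B \<inter> P = {}})"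
  proof (rule bdd_aboveI2)
    fix B assume "B \<in> {B \<in> boxes. B \<inter> P = {}}"
    then obtain x1 y1 x2 y2 where B: "B = {x1..<y1} \<times> {x2..<y2}"
        "0 \<le> x1" "x1 \<le> y1" "y1 \<le> 1" "0 \<le> x2" "x2 \<le> y2" "y2 \<le> 1"
      by (auto simp: boxes_def)
    then have "measure lborel B = (y1 - x1) * (y2 - x2)"
      by (simp add: measure_half_open_box)
    also have "\<dots> \<le> 1" using B by (intro mult_le_one) auto
    finally show "measure lborel B \<le> 1" .
  qed
qed (use assms in auto)

text \<open>Moving the lower and left sides inwards by \<open>e\<close> makes the box half-open inside the open one; the area is
  continuous in \<open>e\<close>.\<close>

lemma open_box_le_dispersion:
  assumes "0 \<le> a" "a < b" "b \<le> 1" "0 \<le> c" "c < d" "d \<le> 1"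
  assumes empty: "({a<..<b} \<times> {c<..<d}) \<inter> P = {}"
  shows "(b - a) * (d - c) \<le> dispersion P"
proof (rule tendsto_upperbound)
  show "((\<lambda>e. (b - (a + e)) * (d - (c + e))) \<longlongrightarrow> (b - a) * (d - c)) (at_right 0)"
    by (auto intro!: tendsto_eq_intros)
  have "(b - (a + e)) * (d - (c + e)) \<le> dispersion P" if "0 < e" "e < b - a" "e < d - c" for e
  proof -
    let ?B = "{a + e..<b} \<times> {c + e..<d}"
    have "?B \<in> boxes" using that assms by (force simp: boxes_def)
    moreover have "?B \<inter> P = {}"
    proof -
      have "?B \<subseteq> {a<..<b} \<times> {c<..<d}" using that by auto
      then show ?thesis using empty by blast
    qed
    ultimately show ?thesis
      using measure_le_dispersion[of ?B P] measure_half_open_box[of "a + e" b "c + e" d] that by simp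
  qed
  moreover have "eventually (\<lambda>e. e < b - a \<and> e < d - c \<and> 0 < e) (at_right 0)"
    using assms by (intro eventually_conj eventually_at_right_less order_tendstoD(2)[OF tendsto_ident_at]) auto
  ultimately show "eventually (\<lambda>e. (b - (a + e)) * (d - (c + e)) \<le> dispersion P) (at_right 0)"
    by (auto elim: eventually_mono)
qed simp

section \<open>The lower bound and the value of the maximum\<close>

lemma dispersion_net_ge:
  assumes "2 \<le> k" "k + 2 \<le> m"
  shows "(2 ^ (k + 1) - 1) / 2 ^ m * (1 / 2 ^ (k - 1) - 1 / 2 ^ m)
       \<le> dispersion (digital_net m (J_mat m) (L_mat m))"
proof -
  define a b c d :: real where "a = 3 / 2 ^ m" and "b = (2 ^ (k + 1) + 2) / 2 ^ m"
    and "c = 1 / 2 - 1 / 2 ^ k" and "d = 1 / 2 + 1 / 2 ^ k - 1 / 2 ^ m"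
  have k4: "(2::real) ^ k \<ge> 4" using power_increasing[of 2 k "2::real"] assms by simp
  have mk: "(2::real) ^ m \<ge> 4 * 2 ^ k" using power_increasing[of "k + 2" m "2::real"] assms by simp
  have "(b - a) * (d - c) \<le> dispersion (digital_net m (J_mat m) (L_mat m))"
  proof (rule open_box_le_dispersion)
    show "0 \<le> a" "a < b" "b \<le> 1" "0 \<le> c"
      using k4 mk by (auto simp: a_def b_def c_def field_simps)
    have "1 / 2 ^ m \<le> 1 / (4 * 2 ^ k :: real)" "(1::real) / 2 ^ k \<le> 1 / 4"
        "(0::real) < 1 / 2 ^ m" "(0::real) < 1 / 2 ^ k"
      using mk k4 by (auto intro!: divide_left_mono)
    moreover have "1 / (4 * 2 ^ k) = 1 / 4 * (1 / 2 ^ k :: real)" by simp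
    ultimately show "c < d" "d \<le> 1" unfolding c_def d_def by linarith+
    show "({a<..<b} \<times> {c<..<d}) \<inter> digital_net m (J_mat m) (L_mat m) = {}"
    proof (rule ccontr)
      assume "({a<..<b} \<times> {c<..<d}) \<inter> digital_net m (J_mat m) (L_mat m) \<noteq> {}"
      then have "\<exists>n<2 ^ m. net_coord m (J_mat m) n \<in> {a<..<b} \<and> net_coord m (L_mat m) n \<in> {c<..<d}"
        by (auto simp: digital_net_def)
      then obtain n where n: "n < 2 ^ m" "net_coord m (J_mat m) n \<in> {a<..<b}"
          "net_coord m (L_mat m) n \<in> {c<..<d}"
        by blast
      then have "3 < real n" "real n < 2 ^ (k + 1) + 2"
        by (auto simp: net_coord_J_mat a_def b_def divide_less_cancel)
      then have "3 < n" "real n < real (2 ^ (k + 1) + 2)" by simp_all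
      then have "3 < n" "n < 2 ^ (k + 1) + 2" by (simp_all only: of_nat_less_iff)
      from binary_sum_away_from_half[OF _ _ parity_digits_return[OF assms(1) this], of m] n(3) assms
      show False by (auto simp: net_coord_L_mat c_def d_def)
    qed
  qed
  moreover have "b - a = (2 ^ (k + 1) - 1) / 2 ^ m"
    by (simp add: a_def b_def flip: diff_divide_distrib)
  moreover have "d - c = 1 / 2 ^ (k - 1) - 1 / 2 ^ m"
    using assms by (cases k) (auto simp: c_def d_def)
  ultimately show ?thesis by simp
qed

text \<open>With \<open>u = 2 ^ k\<close> and \<open>v = 2 ^ (m - k)\<close>, the \<open>k\<close>-th term is decreasing in \<open>u + v\<close>, where
  \<open>u * v = 2 ^ s * 2 ^ t\<close> is fixed. Since no exponent lies strictly between \<open>s\<close> and \<open>t\<close>, the product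
  \<open>(u - 2 ^ s) * (u - 2 ^ t)\<close> is nonnegative, and this says \<open>u + v \<ge> 2 ^ s + 2 ^ t\<close> after division
  by \<open>u\<close>. This integral form of the arithmetic-geometric mean inequality is sharp also for odd \<open>m\<close>.\<close>

lemma Max_box_area:
  fixes s t m :: nat
  assumes m: "m = s + t" and t: "t = s \<or> t = s + 1" and "2 \<le> s"
  shows "(MAX k\<in>{2..m - 2}. (2 ^ (k + 1) - 1) / 2 ^ m * (1 / 2 ^ (k - 1) - 1 / 2 ^ m) :: real)
       = 1 / 2 ^ m * (4 - 2 * (2 ^ s + 2 ^ t) / 2 ^ m + 1 / 2 ^ m)"
proof -
  define f :: "nat \<Rightarrow> real" where
    "f k = (2 ^ (k + 1) - 1) / 2 ^ m * (1 / 2 ^ (k - 1) - 1 / 2 ^ m)" for k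
  have f: "f k = 1 / 2 ^ m * (4 - 2 * (2 ^ k + 2 ^ (m - k)) / 2 ^ m + 1 / 2 ^ m)"
    if k: "1 \<le> k" "k \<le> m" for k
  proof -
    \<comment> \<open>Everything becomes a rational identity in \<open>p\<close> and \<open>q\<close>; halving \<open>2 ^ k\<close> accounts for the
      exponent \<open>k - 1\<close>.\<close>
    define p q :: real where "p = 2 ^ (k - 1)" and "q = 2 ^ (m - k)"
    have pq: "p \<noteq> 0" "q \<noteq> 0" by (simp_all add: p_def q_def)
    have k_eq: "(2::real) ^ k = 2 * p"
      using k unfolding p_def by (cases k) auto
    then have k1_eq: "(2::real) ^ (k + 1) = 2 * (2 * p)" by simp
    have m_eq: "(2::real) ^ m = 2 * p * q"
      using k unfolding k_eq [symmetric] q_def by (simp flip: power_add)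
    have "(2 * (2 * p) - 1) / (2 * p * q) * (1 / p - 1 / (2 * p * q))
        = 1 / (2 * p * q) * (4 - 2 * (2 * p + q) / (2 * p * q) + 1 / (2 * p * q))"
      using pq by (simp add: field_simps)
    then show ?thesis
      by (simp only: f_def k1_eq m_eq k_eq flip: p_def q_def)
  qed
  have "(MAX k\<in>{2..m - 2}. f k) = f s"
  proof (rule Max_eqI)
    fix x assume "x \<in> f ` {2..m - 2}"
    then obtain k where k: "2 \<le> k" "k \<le> m - 2" "x = f k" by auto
    define u v :: real where "u = 2 ^ k" and "v = 2 ^ (m - k)"
    have "u > 0" by (simp add: u_def)
    have uv: "u * v = 2 ^ s * 2 ^ t"
      using k m by (simp add: u_def v_def flip: power_add)
    have "0 \<le> (u - 2 ^ s) * (u - 2 ^ t)"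
    proof (cases "k \<le> s")
      case True
      then have "u \<le> 2 ^ s" "u \<le> 2 ^ t"
        using t unfolding u_def by (auto intro!: power_increasing)
      then show ?thesis by (intro mult_nonpos_nonpos) auto
    next
      case False
      then have "2 ^ s \<le> u" "2 ^ t \<le> u"
        using t unfolding u_def by (auto intro!: power_increasing)
      then show ?thesis by simp
    qed
    then have "u * (2 ^ s + 2 ^ t) \<le> u * (u + v)"
      using uv by (simp add: algebra_simps)
    then have "2 ^ s + 2 ^ t \<le> u + v" using \<open>u > 0\<close> by simp
    then have "f k \<le> f s"
      using k assms f[of k] f[of s] unfolding u_def v_def
      by (simp add: divide_right_mono mult_left_mono)
    then show "x \<le> f s" using k by simp
  qed (use assms in auto)
  then show ?thesis using f[of s] assms by (simp add: f_def)
qed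

theorem theorem4p4:
  fixes m :: nat
  assumes "4 \<le> m"
  shows "dispersion (digital_net m (J_mat m) (L_mat m)) \<ge>
           (MAX k\<in>{2..m - 2}. (2 ^ (k + 1) - 1) / 2 ^ m * (1 / 2 ^ (k - 1) - 1 / 2 ^ m) :: real)
       \<and> (MAX k\<in>{2..m - 2}. (2 ^ (k + 1) - 1) / 2 ^ m * (1 / 2 ^ (k - 1) - 1 / 2 ^ m) :: real) =
           (if even m
            then 1 / 2 ^ m * (4 - 4 / 2 powr (real m / 2) + 1 / 2 ^ m)
            else 1 / 2 ^ m * (4 - 3 / 2 powr ((real m - 1) / 2) + 1 / 2 ^ m))"
proof (intro conjI)
  show "dispersion (digital_net m (J_mat m) (L_mat m)) \<ge>
      (MAX k\<in>{2..m - 2}. (2 ^ (k + 1) - 1) / 2 ^ m * (1 / 2 ^ (k - 1) - 1 / 2 ^ m))"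
    using assms dispersion_net_ge [of _ m] by (subst Max_le_iff) auto
next
  define s where "s = m div 2"
  have "2 \<le> s" using assms by (simp add: s_def)
  show "(MAX k\<in>{2..m - 2}. (2 ^ (k + 1) - 1) / 2 ^ m * (1 / 2 ^ (k - 1) - 1 / 2 ^ m) :: real) =
           (if even m
            then 1 / 2 ^ m * (4 - 4 / 2 powr (real m / 2) + 1 / 2 ^ m)
            else 1 / 2 ^ m * (4 - 3 / 2 powr ((real m - 1) / 2) + 1 / 2 ^ m))"
  proof (cases "even m")
    case True
    then have m: "m = s + s" unfolding s_def by presburger
    then have "2 powr (real m / 2) = (2 ^ s :: real)"
      by (simp flip: powr_realpow)
    moreover have "2 * (2 ^ s + 2 ^ s) / 2 ^ m = 4 / (2 ^ s :: real)"
      unfolding m by (simp add: power_add)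
    moreover note Max_box_area[OF m _ \<open>2 \<le> s\<close>]
    ultimately show ?thesis using True by simp
  next
    case False
    then have m: "m = s + (s + 1)" unfolding s_def by presburger
    then have "2 powr ((real m - 1) / 2) = (2 ^ s :: real)"
      by (simp flip: powr_realpow)
    moreover have "2 * (2 ^ s + 2 ^ (s + 1)) / 2 ^ m = 3 / (2 ^ s :: real)"
      unfolding m by (simp add: power_add)
    moreover note Max_box_area[OF m _ \<open>2 \<le> s\<close>]
    ultimately show ?thesis using False by simp
  qed
qed

end
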